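(* Let $f_1$ be a strictly increasing polynomial on $[a,b]$ ($a<b$), of degree $m$, and let $s-1\ge 0$ denote the largest order of the zeros that $f_1'$ may have in $[a,b]$ (with $s-1=0$ if $f_1'$ has no zeros in $[a,b]$). Then there exist constants $n_0\ge m$ and $K>0$ such that $B_n^{f_1}$ is well defined whenever $n\ge n_0$, and for all $n\ge n_0$ and all $0\le k\le n$, $$\left|t_{n,k}-\left(a+\frac{k}{n}(b-a)\right)\right|\le\frac{K}{n^{1/s}},$$ where the points $t_{n,k}=f_1^{-1}(\gamma_{n,k})$ are the nodes of $B_n^{f_1}$.
   Context: $\mathbb{P}_n[a,b]$ is the space of real polynomials of degree at most $n$ on $[a,b]$, with the standard Bernstein basis $p_{n,k}(x)=\binom{n}{k}\frac{(x-a)^k(b-x)^{n-k}}{(b-a)^n}$, $k=0,\dots,n$. The $\gamma_{n,k}$ are defined by $f_1=\sum_{k=0}^n\gamma_{n,k}p_{n,k}$. A generalized Bernstein operator $C[a,b]\to\mathbb{P}_n[a,b]$ is an operator of the form $f\mapsto\sum_{k=0}^n f(t_{n,k})\,\alpha_{n,k}\,p_{n,k}$ with nodes $t_{n,k}\in[a,b]$ and weights $\alpha_{n,k}>0$. $B_n^{f_1}$ is the unique (if it exists) generalized Bernstein operator fixing (i.e. mapping to themselves) the constant function $\mathbf{1}$ and $f_1$; it has weights $\alpha_{n,k}=1$ and nodes $t_{n,k}=f_1^{-1}(\gamma_{n,k})$, and it is well defined exactly when all $\gamma_{n,k}\in[f_1(a),f_1(b)]$. *)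

theory Defs
  imports "HOL-Analysis.Analysis" "HOL-Computational_Algebra.Polynomial"
begin

definition bernstein_basis :: "real \<Rightarrow> real \<Rightarrow> nat \<Rightarrow> nat \<Rightarrow> real \<Rightarrow> real" where
  "bernstein_basis a b n k x =
     real (n choose k) * ((x - a) ^ k * (b - x) ^ (n - k)) / (b - a) ^ n"

text \<open>Coefficients in the Bernstein basis on \<open>[a,b]\<close>; setting them to \<open>0\<close> for \<open>k > n\<close> makes
  the family \<open>\<gamma>\<close> unique as a total function.\<close>

definition bernstein_coeff :: "real \<Rightarrow> real \<Rightarrow> nat \<Rightarrow> (real \<Rightarrow> real) \<Rightarrow> nat \<Rightarrow> real" where
  "bernstein_coeff a b n f =
     (THE \<gamma>. (\<forall>k>n. \<gamma> k = 0) \<and>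
             (\<forall>x\<in>{a..b}. f x = (\<Sum>k\<le>n. \<gamma> k * bernstein_basis a b n k x)))"

text \<open>\<open>L\<close> is the generalized Bernstein operator with nodes \<open>t 0, \<dots>, t n\<close> and weights
  \<open>\<alpha> 0, \<dots>, \<alpha> n\<close>. Functions on \<open>[a,b]\<close> are total functions here; restricting \<open>L\<close> to
  continuous arguments and its values to \<open>{a..b}\<close> makes equality of such \<open>L\<close> coincide with
  equality of operators on \<open>C[a,b]\<close>.\<close>

definition gen_bernstein_with ::
  "real \<Rightarrow> real \<Rightarrow> nat \<Rightarrow> (nat \<Rightarrow> real) \<Rightarrow> (nat \<Rightarrow> real) \<Rightarrow> ((real \<Rightarrow> real) \<Rightarrow> real \<Rightarrow> real) \<Rightarrow> bool" where
  "gen_bernstein_with a b n t \<alpha> L \<longleftrightarrow>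
     (\<forall>k\<le>n. t k \<in> {a..b} \<and> \<alpha> k > 0) \<and>
     L = (\<lambda>f\<in>{f. continuous_on {a..b} f}. \<lambda>x\<in>{a..b}.
            \<Sum>k\<le>n. f (t k) * \<alpha> k * bernstein_basis a b n k x)"

definition gen_bernstein_operator ::
  "real \<Rightarrow> real \<Rightarrow> nat \<Rightarrow> ((real \<Rightarrow> real) \<Rightarrow> real \<Rightarrow> real) \<Rightarrow> bool" where
  "gen_bernstein_operator a b n L \<longleftrightarrow> (\<exists>t \<alpha>. gen_bernstein_with a b n t \<alpha> L)"

definition fixes_on :: "real \<Rightarrow> real \<Rightarrow> ((real \<Rightarrow> real) \<Rightarrow> real \<Rightarrow> real) \<Rightarrow> (real \<Rightarrow> real) \<Rightarrow> bool" where
  "fixes_on a b L f \<longleftrightarrow> (\<forall>x\<in>{a..b}. L f x = f x)"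

definition bernstein_well_defined :: "real \<Rightarrow> real \<Rightarrow> nat \<Rightarrow> (real \<Rightarrow> real) \<Rightarrow> bool" where
  "bernstein_well_defined a b n f1 \<longleftrightarrow>
     (\<exists>!L. gen_bernstein_operator a b n L \<and> fixes_on a b L (\<lambda>_. 1) \<and> fixes_on a b L f1)"

definition bernstein_op :: "real \<Rightarrow> real \<Rightarrow> nat \<Rightarrow> (real \<Rightarrow> real) \<Rightarrow> (real \<Rightarrow> real) \<Rightarrow> real \<Rightarrow> real" where
  "bernstein_op a b n f1 =
     (THE L. gen_bernstein_operator a b n L \<and> fixes_on a b L (\<lambda>_. 1) \<and> fixes_on a b L f1)"

definition bernstein_node :: "real \<Rightarrow> real \<Rightarrow> nat \<Rightarrow> (real \<Rightarrow> real) \<Rightarrow> nat \<Rightarrow> real" where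
  "bernstein_node a b n f1 k = the_inv_into {a..b} f1 (bernstein_coeff a b n f1 k)"

text \<open>The inserted \<open>0\<close> is the value when \<open>q\<close> has no zeros in \<open>[a,b]\<close>; it does not affect the
  maximum otherwise. The set is finite for \<open>q \<noteq> 0\<close>.\<close>

definition max_zero_order :: "real \<Rightarrow> real \<Rightarrow> real poly \<Rightarrow> nat" where
  "max_zero_order a b q = Max (insert 0 ((\<lambda>x. order x q) ` {x\<in>{a..b}. poly q x = 0}))"

end

theory Submission
  imports Defs
begin

text \<open>Rescale \<open>[a, b]\<close> to \<open>[0, 1]\<close> and put \<open>p y = f1 (a + y (b - a))\<close>. The coefficients of
  \<open>y\<^sup>j\<close> in the Bernstein basis of degree \<open>n\<close> are \<open>(k choose j) / (n choose j)\<close>, which differ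
  from \<open>(k / n)\<^sup>j\<close> by at most \<open>j\<^sup>2 / n\<close>. Summing over the monomials of \<open>p\<close> gives
  \<open>\<bar>\<gamma>\<^sub>k - p (k / n)\<bar> \<le> C / n\<close> uniformly in \<open>k\<close> (\<open>poly_Bernstein_coeff_approx\<close>).

  That bound alone does not keep \<open>\<gamma>\<^sub>k\<close> inside \<open>[p 0, p 1]\<close> when \<open>k / n\<close> is close to an
  endpoint. Near \<open>0\<close> one writes \<open>p y - p 0 = y\<^sup>r q y\<close> with \<open>q 0 > 0\<close>. The coefficients of
  \<open>y\<^sup>r\<^sup>+\<^sup>i\<close> with \<open>i \<ge> 1\<close> are at most \<open>k / n\<close> times the one of \<open>y\<^sup>r\<close>, so for \<open>k / n\<close> below
  some fixed \<open>\<delta>\<close> the leading term decides the sign and \<open>\<gamma>\<^sub>k \<ge> p 0\<close>; for \<open>k / n > \<delta>\<close> the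
  error \<open>C / n\<close> is eventually smaller than \<open>p \<delta> - p 0\<close> (\<open>poly_Bernstein_coeff_lower\<close>). The
  upper bound follows by the reflection \<open>p y \<mapsto> - p (1 - y)\<close>. Hence the nodes \<open>t\<^sub>k\<close> exist for
  large \<open>n\<close>, and linear independence of the Bernstein basis makes the operator unique
  (\<open>bernstein_op_exists\<close>).

  For the rate, \<open>f1\<close> satisfies \<open>f1 y - f1 x \<ge> c (y - x)\<^sup>s\<close> for \<open>x \<le> y\<close> in \<open>[a, b]\<close>
  (\<open>poly_increment_ge\<close>): near a point \<open>z\<close>, \<open>\<bar>f1' u\<bar>\<close> is at least a constant times \<open>\<bar>u - z\<bar>\<^sup>r\<close>
  with \<open>r < s\<close>, and the local estimates are glued by bisection. Applied to \<open>t\<^sub>k\<close> and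
  \<open>x\<^sub>k = a + (k / n) (b - a)\<close>, this gives
  \<open>c \<bar>t\<^sub>k - x\<^sub>k\<bar>\<^sup>s \<le> \<bar>\<gamma>\<^sub>k - p (k / n)\<bar> \<le> C / n\<close>.\<close>

section \<open>Bernstein coefficients of polynomials on the unit interval\<close>

text \<open>The \<open>k\<close>-th coefficient of the monomial \<open>y\<^sup>j\<close> in the Bernstein basis of degree \<open>n \<ge> j\<close>
  on \<open>[0, 1]\<close>. It equals the ratio of falling factorials
  \<open>k (k - 1) \<dots> (k - j + 1) / (n (n - 1) \<dots> (n - j + 1))\<close>.\<close>

definition falling_ratio :: "nat \<Rightarrow> nat \<Rightarrow> nat \<Rightarrow> real" where
  "falling_ratio n k j = real (k choose j) / real (n choose j)"

text \<open>The \<open>k\<close>-th coefficient of \<open>p\<close> in the Bernstein basis of degree \<open>n\<close> on \<open>[0, 1]\<close>;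
  meaningful for \<open>degree p \<le> n\<close>.\<close>
definition poly_Bernstein_coeff :: "real poly \<Rightarrow> nat \<Rightarrow> nat \<Rightarrow> real" where
  "poly_Bernstein_coeff p n k = (\<Sum>j\<le>degree p. coeff p j * falling_ratio n k j)"

lemma Bernstein_coeffs_unique:
  assumes eq: "\<And>y. y \<in> {0..1} \<Longrightarrow>
      (\<Sum>k\<le>n. c k * Bernstein n k y) = (\<Sum>k\<le>n. d k * Bernstein n k y)"
    and "k \<le> n"
  shows "c k = d k"
proof -
  define e where "e = (\<lambda>k. (c k - d k) * real (n choose k))"
  \<comment> \<open>Substituting \<open>y = z / (1 + z)\<close> and clearing denominators turns the Bernstein basis
    into the monomials.\<close>
  have "(\<Sum>k\<le>n. e k * z ^ k) = 0" if "z > 0" for z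
  proof -
    define y where "y = z / (1 + z)"
    have y: "y \<in> {0..1}" "1 - y = 1 / (1 + z)"
      using that by (auto simp: y_def field_simps)
    have "(\<Sum>k\<le>n. e k * z ^ k) = (\<Sum>k\<le>n. (c k - d k) * Bernstein n k y) * (1 + z) ^ n"
      unfolding sum_distrib_right
    proof (rule sum.cong)
      fix k assume "k \<in> {..n}"
      then have "(1 + z) ^ n = (1 + z) ^ k * (1 + z) ^ (n - k)"
        by (simp flip: power_add)
      then show "e k * z ^ k = (c k - d k) * Bernstein n k y * (1 + z) ^ n"
        using that unfolding Bernstein_def e_def y(2) by (simp add: y_def power_divide)
    qed simp
    also have "(\<Sum>k\<le>n. (c k - d k) * Bernstein n k y) = 0"
      using eq[OF y(1)] by (simp add: left_diff_distrib sum_subtractf)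
    finally show ?thesis by simp
  qed
  then have "{0<..} \<subseteq> {z. (\<Sum>k\<le>n. e k * z ^ k) = 0}" by auto
  then have "infinite {z. (\<Sum>k\<le>n. e k * z ^ k) = 0}"
    using infinite_Ioi finite_subset by blast
  then have "e k = 0"
    using polyfun_finite_roots[of e n] \<open>k \<le> n\<close> by auto
  then show ?thesis using \<open>k \<le> n\<close> by (simp add: e_def)
qed

lemma power_eq_sum_Bernstein:
  assumes "j \<le> n"
  shows "(\<Sum>k\<le>n. falling_ratio n k j * Bernstein n k y) = y ^ j"
proof -
  have "(\<Sum>k\<le>n. falling_ratio n k j * Bernstein n k y)
      = (\<Sum>k\<in>{j..n}. falling_ratio n k j * Bernstein n k y)"
    by (rule sum.mono_neutral_right) (auto simp: falling_ratio_def)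
  also have "\<dots> = (\<Sum>i\<le>n - j. falling_ratio n (i + j) j * Bernstein n (i + j) y)"
    using assms by (intro sum.reindex_bij_witness[of _ "\<lambda>i. i + j" "\<lambda>k. k - j"]) auto
  also have "\<dots> = (\<Sum>i\<le>n - j. y ^ j * Bernstein (n - j) i y)"
  proof (rule sum.cong)
    fix i assume "i \<in> {..n - j}"
    then have i: "i + j \<le> n" using assms by auto
    have "(n choose (i + j)) * ((i + j) choose j) = (n choose j) * ((n - j) choose i)"
      using choose_mult[of j "i + j" n] i by simp
    then have "real (n choose (i + j)) * real ((i + j) choose j)
        = real (n choose j) * real ((n - j) choose i)"
      by (metis of_nat_mult)
    moreover have "n choose j > 0" using assms by simp
    ultimately have "falling_ratio n (i + j) j * real (n choose (i + j)) = real ((n - j) choose i)"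
      by (simp add: falling_ratio_def field_simps)
    then show "falling_ratio n (i + j) j * Bernstein n (i + j) y = y ^ j * Bernstein (n - j) i y"
      by (simp add: Bernstein_def power_add algebra_simps)
  qed simp
  also have "\<dots> = y ^ j"
    by (simp flip: sum_distrib_left)
  finally show ?thesis .
qed

lemma poly_eq_sum_Bernstein:
  assumes "degree p \<le> n"
  shows "poly p y = (\<Sum>k\<le>n. poly_Bernstein_coeff p n k * Bernstein n k y)"
proof -
  have "(\<Sum>k\<le>n. poly_Bernstein_coeff p n k * Bernstein n k y)
      = (\<Sum>j\<le>degree p. coeff p j * (\<Sum>k\<le>n. falling_ratio n k j * Bernstein n k y))"
    unfolding poly_Bernstein_coeff_def sum_distrib_right sum_distrib_left
    by (subst sum.swap) (simp add: mult_ac)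
  also have "\<dots> = poly p y"
    unfolding poly_altdef using assms by (intro sum.cong) (auto simp: power_eq_sum_Bernstein)
  finally show ?thesis by simp
qed

section \<open>Comparison of the coefficients with point values\<close>

lemma falling_ratio_nonneg: "falling_ratio n k j \<ge> 0"
  by (simp add: falling_ratio_def)

lemma falling_ratio_0 [simp]: "falling_ratio n k 0 = 1"
  by (simp add: falling_ratio_def)

lemma falling_ratio_Suc:
  assumes "j < n"
  shows "falling_ratio n k (Suc j) = falling_ratio n k j * ((real k - real j) / (real n - real j))"
proof -
  have ch: "real (i choose Suc j) = real (i choose j) * (real i - real j) / real (Suc j)" for i
  proof (cases "j \<le> i")
    case True
    have "Suc j * (i choose Suc j) = (i - j) * (i choose j)"
      by (simp only: binomial_absorption binomial_absorb_comp)
    then have "real (Suc j) * real (i choose Suc j) = (real i - real j) * real (i choose j)"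
      using True by (metis of_nat_diff of_nat_mult)
    then show ?thesis by (simp add: field_simps del: of_nat_Suc)
  qed (simp add: binomial_eq_0)
  have "real (n choose j) > 0" using assms by simp
  then show ?thesis using assms
    unfolding falling_ratio_def ch by simp
qed

lemma falling_ratio_Suc_le:
  assumes "j < n" "k \<le> n"
  shows "falling_ratio n k (Suc j) \<le> falling_ratio n k j * (real k / real n)"
proof (cases "j \<le> k")
  case True
  have "(real k - real j) / (real n - real j) \<le> real k / real n"
    using assms True by (simp add: field_simps mult_mono)
  then show ?thesis
    unfolding falling_ratio_Suc[OF assms(1)]
    by (intro mult_left_mono falling_ratio_nonneg)
qed (simp add: falling_ratio_def binomial_eq_0)

lemma falling_ratio_antimono:
  assumes "i \<le> j" "j \<le> n" "k \<le> n"
  shows "falling_ratio n k j \<le> falling_ratio n k i"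
  using assms(1,2)
proof (induction j rule: dec_induct)
  case (step j)
  have "falling_ratio n k (Suc j) \<le> falling_ratio n k j * (real k / real n)"
    using step assms by (intro falling_ratio_Suc_le) auto
  also have "\<dots> \<le> falling_ratio n k j"
    using assms(3) by (intro mult_left_le falling_ratio_nonneg) (auto simp: divide_le_eq)
  finally show ?case using step by simp
qed simp

text \<open>One step from \<open>j\<close> to \<open>j + 1\<close> multiplies the ratio by \<open>(k - j) / (n - j)\<close> instead of
  \<open>k / n\<close>, which adds an error of at most \<open>j / n\<close>.\<close>
lemma falling_ratio_approx:
  assumes "j \<le> n" "k \<le> n"
  shows "\<bar>falling_ratio n k j - (real k / real n) ^ j\<bar> \<le> real j ^ 2 / real n"
  using assms(1)
proof (induction j)
  case (Suc j)
  define y where "y = real k / real n"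
  define R where "R = falling_ratio n k j"
  define z where "z = (real k - real j) / (real n - real j)"
  have y: "0 \<le> y" "y \<le> 1" using assms by (auto simp: y_def divide_le_eq)
  have R: "0 \<le> R" "R \<le> 1"
    using falling_ratio_nonneg falling_ratio_antimono[of 0 j n k] Suc.prems assms
    by (auto simp: R_def)
  have IH: "\<bar>R - y ^ j\<bar> \<le> real j ^ 2 / real n"
    using Suc by (simp add: R_def y_def)
  have "R * \<bar>z - y\<bar> \<le> real j / real n"
  proof (cases "j \<le> k")
    case True
    have "y - z = real j / real n * ((real n - real k) / (real n - real j))"
      using Suc.prems by (simp add: y_def z_def field_simps)
    moreover have "(real n - real k) / (real n - real j) \<le> 1" "(real n - real k) / (real n - real j) \<ge> 0"
      using Suc.prems True assms by (auto simp: divide_le_eq)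
    ultimately have "\<bar>z - y\<bar> \<le> real j / real n"
      by (metis abs_minus_commute abs_mult abs_of_nonneg divide_nonneg_nonneg mult_left_le of_nat_0_le_iff)
    then show ?thesis using R mult_mono[of R 1 "\<bar>z - y\<bar>" "real j / real n"] by auto
  next
    case False
    then show ?thesis by (simp add: R_def falling_ratio_def binomial_eq_0)
  qed
  moreover have "\<bar>R - y ^ j\<bar> * y \<le> \<bar>R - y ^ j\<bar>"
    using y by (intro mult_left_le) auto
  moreover have "\<bar>R * z - y ^ Suc j\<bar> \<le> R * \<bar>z - y\<bar> + \<bar>R - y ^ j\<bar> * y"
  proof -
    have "R * z - y ^ Suc j = R * (z - y) + (R - y ^ j) * y" by (simp add: algebra_simps)
    then show ?thesis using abs_triangle_ineq[of "R * (z - y)" "(R - y ^ j) * y"] R y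
      by (simp add: abs_mult)
  qed
  ultimately have "\<bar>R * z - y ^ Suc j\<bar> \<le> real j / real n + real j ^ 2 / real n"
    using IH by linarith
  also have "\<dots> \<le> real (Suc j) ^ 2 / real n"
    by (simp add: power2_eq_square algebra_simps divide_right_mono flip: add_divide_distrib)
  finally show ?case
    using Suc.prems falling_ratio_Suc[of j n k] by (simp add: R_def y_def z_def)
qed simp

lemma poly_Bernstein_coeff_approx:
  obtains C where "C > 0"
    "\<And>n k. degree p \<le> n \<Longrightarrow> k \<le> n \<Longrightarrow>
       \<bar>poly_Bernstein_coeff p n k - poly p (real k / real n)\<bar> \<le> C / real n"
proof
  define C where "C = (\<Sum>j\<le>degree p. \<bar>coeff p j\<bar> * real j ^ 2) + 1"
  have "(\<Sum>j\<le>degree p. \<bar>coeff p j\<bar> * real j ^ 2) \<ge> 0" by (intro sum_nonneg) auto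
  then show "C > 0" by (simp add: C_def)
  fix n k assume nk: "degree p \<le> n" "k \<le> n"
  have "\<bar>poly_Bernstein_coeff p n k - poly p (real k / real n)\<bar>
      = \<bar>\<Sum>j\<le>degree p. coeff p j * (falling_ratio n k j - (real k / real n) ^ j)\<bar>"
    by (simp add: poly_Bernstein_coeff_def poly_altdef algebra_simps sum_subtractf)
  also have "\<dots> \<le> (\<Sum>j\<le>degree p. \<bar>coeff p j\<bar> * (real j ^ 2 / real n))"
    using nk by (intro sum_abs[THEN order_trans] sum_mono, unfold abs_mult)
      (intro mult_left_mono falling_ratio_approx, auto)
  also have "\<dots> = (C - 1) / real n"
    by (simp add: C_def sum_divide_distrib)
  also have "\<dots> \<le> C / real n" by (intro divide_right_mono) auto
  finally show "\<bar>poly_Bernstein_coeff p n k - poly p (real k / real n)\<bar> \<le> C / real n" .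
qed

section \<open>The coefficients stay in the range of an increasing polynomial\<close>

text \<open>The polynomial on the left is \<open>y \<mapsto> - p (1 - y)\<close>, which is increasing on \<open>[0, 1]\<close>
  when \<open>p\<close> is; it exchanges the roles of the two endpoints.\<close>
lemma poly_Bernstein_coeff_reflect:
  assumes "degree p \<le> n" "k \<le> n"
  shows "poly_Bernstein_coeff (- pcompose p [:1, -1:]) n k = - poly_Bernstein_coeff p n (n - k)"
proof (rule Bernstein_coeffs_unique[OF _ assms(2)])
  fix y :: real
  have "degree (- pcompose p [:1, -1:]) = degree p" by (simp add: degree_pcompose)
  then have "(\<Sum>k\<le>n. poly_Bernstein_coeff (- pcompose p [:1, -1:]) n k * Bernstein n k y)
      = - poly p (1 - y)"
    using assms(1) by (subst poly_eq_sum_Bernstein[symmetric]) (auto simp: poly_pcompose)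
  also have "\<dots> = - (\<Sum>k\<le>n. poly_Bernstein_coeff p n k * Bernstein n k (1 - y))"
    using assms(1) by (simp add: poly_eq_sum_Bernstein)
  also have "\<dots> = - (\<Sum>k\<le>n. poly_Bernstein_coeff p n (n - k) * Bernstein n (n - k) (1 - y))"
    by (rule arg_cong[where f = uminus],
        rule sum.reindex_bij_witness[of _ "\<lambda>k. n - k" "\<lambda>k. n - k"]) auto
  also have "\<dots> = (\<Sum>k\<le>n. - poly_Bernstein_coeff p n (n - k) * Bernstein n k y)"
    unfolding sum_negf[symmetric]
    by (intro sum.cong) (auto simp: Bernstein_def simp flip: binomial_symmetric)
  finally show "(\<Sum>k\<le>n. poly_Bernstein_coeff (- pcompose p [:1, -1:]) n k * Bernstein n k y) = \<dots>" .
qed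

lemma poly_Bernstein_coeff_lower:
  assumes mono: "strict_mono_on {0..1} (poly p)"
  obtains N where "\<And>n k. n \<ge> N \<Longrightarrow> k \<le> n \<Longrightarrow> poly p 0 \<le> poly_Bernstein_coeff p n k"
proof -
  define g where "g = p - [:poly p 0:]"
  have gpos: "poly g y > 0" if "0 < y" "y \<le> 1" for y
    using strict_mono_onD[OF mono, of 0 y] that by (simp add: g_def)
  have "g \<noteq> 0" using gpos[of 1] by auto
  \<comment> \<open>\<open>p y - p 0 = y\<^sup>r q y\<close> with \<open>q 0 > 0\<close>\<close>
  define r where "r = order 0 g"
  obtain q where q: "g = [:- 0, 1:] ^ r * q" "\<not> [:- 0, 1:] dvd q"
    using order_decomp[OF \<open>g \<noteq> 0\<close>, of 0] unfolding r_def by blast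
  have gq: "poly g y = y ^ r * poly q y" for y by (simp add: q(1))
  have "poly q 0 \<noteq> 0" using q(2) by (simp add: poly_eq_0_iff_dvd)
  moreover have "poly q 0 \<ge> 0"
  proof (rule tendsto_lowerbound)
    show "(poly q \<longlongrightarrow> poly q 0) (at_right 0)"
      by (intro tendsto_intros)
    have "poly q y \<ge> 0" if "0 < y" "y < 1" for y
      using gpos[of y] that unfolding gq by (simp add: zero_less_mult_iff)
    then show "\<forall>\<^sub>F y in at_right 0. 0 \<le> poly q y"
      by (auto simp: eventually_at_right_field intro: exI[of _ 1])
  qed simp
  ultimately have q0: "coeff q 0 > 0" by (simp add: poly_0_coeff_0)
  define S where "S = (\<Sum>i\<in>{1..degree q}. \<bar>coeff q i\<bar>)"
  have S: "S \<ge> 0" by (simp add: S_def sum_nonneg)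
  \<comment> \<open>Below \<open>\<delta>\<close> the constant coefficient of \<open>q\<close> dominates all the others together.\<close>
  define \<delta> where "\<delta> = min 1 (coeff q 0 / (S + 1))"
  have \<delta>: "0 < \<delta>" "\<delta> \<le> 1" "\<delta> * S \<le> coeff q 0"
  proof -
    show "0 < \<delta>" "\<delta> \<le> 1" using q0 S by (auto simp: \<delta>_def)
    have "\<delta> * S \<le> coeff q 0 / (S + 1) * (S + 1)"
      using S q0 by (intro mult_mono) (auto simp: \<delta>_def)
    then show "\<delta> * S \<le> coeff q 0" using S by simp
  qed
  obtain C where C: "C > 0" "\<And>n k. degree p \<le> n \<Longrightarrow> k \<le> n \<Longrightarrow>
       \<bar>poly_Bernstein_coeff p n k - poly p (real k / real n)\<bar> \<le> C / real n"
    using poly_Bernstein_coeff_approx by blast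
  have gd: "poly g \<delta> > 0" using gpos \<delta> by auto
  define N where "N = max (max 1 (degree p)) (nat \<lceil>C / poly g \<delta>\<rceil>)"
  have deg: "degree g \<le> degree p"
    unfolding g_def by (intro degree_diff_le) auto
  have "poly p 0 \<le> poly_Bernstein_coeff p n k" if nN: "n \<ge> N" and kn: "k \<le> n" for n k
  proof (cases "real k / real n \<le> \<delta>")
    case True
    have "q \<noteq> 0" using q0 by auto
    then have degq: "degree g = r + degree q"
      unfolding q(1) by (subst degree_mult_eq) (auto simp: degree_power_eq)
    have rn: "r + degree q \<le> n" using nN degq deg by (simp add: N_def)
    have gm: "g = monom 1 r * q" by (simp add: q(1) monom_altdef)
    have cg: "coeff g (r + i) = coeff q i" for i
      by (simp add: gm coeff_monom_mult)
    have cg0: "coeff g j = 0" if "j < r" for j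
      using that by (simp add: gm coeff_monom_mult)
    have "poly_Bernstein_coeff p n k - poly p 0
        = (\<Sum>j\<le>degree p. coeff g j * falling_ratio n k j)"
    proof -
      have "(\<Sum>j\<le>degree p. coeff g j * falling_ratio n k j)
        = poly_Bernstein_coeff p n k - (\<Sum>j\<le>degree p. coeff [:poly p 0:] j * falling_ratio n k j)"
        by (simp add: poly_Bernstein_coeff_def g_def left_diff_distrib sum_subtractf)
      also have "(\<Sum>j\<le>degree p. coeff [:poly p 0:] j * falling_ratio n k j)
         = (\<Sum>j\<in>{0}. coeff [:poly p 0:] j * falling_ratio n k j)"
        by (rule sum.mono_neutral_right) (auto simp: coeff_pCons split: nat.split)
      finally show ?thesis by simp
    qed
    also have "\<dots> = (\<Sum>j\<in>{r..r + degree q}. coeff g j * falling_ratio n k j)"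
      by (rule sum.mono_neutral_right) (use cg0 degq deg in \<open>auto simp: coeff_eq_0 not_le\<close>)
    also have "\<dots> = (\<Sum>i\<in>{0..degree q}. coeff q i * falling_ratio n k (r + i))"
      using sum.shift_bounds_cl_nat_ivl[of "\<lambda>j. coeff g j * falling_ratio n k j" 0 r "degree q"]
      by (simp add: cg add.commute[of _ r])
    also have "\<dots> = coeff q 0 * falling_ratio n k r
        + (\<Sum>i\<in>{1..degree q}. coeff q i * falling_ratio n k (r + i))"
      by (simp add: sum.atLeast_Suc_atMost)
    also have "\<dots> \<ge> 0"
    proof -
      have "- (\<Sum>i\<in>{1..degree q}. coeff q i * falling_ratio n k (r + i))
          \<le> (\<Sum>i\<in>{1..degree q}. \<bar>coeff q i\<bar> * (falling_ratio n k r * \<delta>))"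
        unfolding sum_negf[symmetric]
      proof (rule sum_mono)
        fix i assume i: "i \<in> {1..degree q}"
        have "falling_ratio n k (r + i) \<le> falling_ratio n k (Suc r)"
          using i rn kn by (intro falling_ratio_antimono) auto
        also have "\<dots> \<le> falling_ratio n k r * (real k / real n)"
          using i rn kn by (intro falling_ratio_Suc_le) auto
        also have "\<dots> \<le> falling_ratio n k r * \<delta>"
          using True by (intro mult_left_mono falling_ratio_nonneg)
        finally have "\<bar>coeff q i\<bar> * falling_ratio n k (r + i) \<le> \<bar>coeff q i\<bar> * (falling_ratio n k r * \<delta>)"
          by (intro mult_left_mono) auto
        moreover have "- (coeff q i * falling_ratio n k (r + i)) \<le> \<bar>coeff q i\<bar> * falling_ratio n k (r + i)"
          using mult_right_mono[OF abs_ge_minus_self[of "coeff q i"] falling_ratio_nonneg[of n k "r + i"]] by simp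
        ultimately show "- (coeff q i * falling_ratio n k (r + i)) \<le> \<bar>coeff q i\<bar> * (falling_ratio n k r * \<delta>)"
          by linarith
      qed
      also have "\<dots> = falling_ratio n k r * (\<delta> * S)"
        by (simp add: S_def sum_distrib_left mult_ac)
      also have "\<dots> \<le> falling_ratio n k r * coeff q 0"
        using \<delta> by (intro mult_left_mono falling_ratio_nonneg)
      finally show ?thesis by (simp add: mult.commute)
    qed
    finally show ?thesis by simp
  next
    case False
    have n: "n > 0" "degree p \<le> n" "C / poly g \<delta> \<le> real n"
      using nN by (auto simp: N_def nat_le_iff ceiling_le_iff)
    have "C / real n \<le> poly g \<delta>" using n gd by (simp add: field_simps)
    also have "\<dots> \<le> poly p (real k / real n) - poly p 0"
      using strict_mono_on_leD[OF mono, of \<delta> "real k / real n"] False \<delta> kn n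
      by (auto simp: g_def divide_le_eq)
    finally show ?thesis using C(2)[OF n(2) kn] by linarith
  qed
  then show ?thesis using that by blast
qed


lemma poly_Bernstein_coeff_upper:
  assumes mono: "strict_mono_on {0..1} (poly p)"
  obtains N where "\<And>n k. n \<ge> N \<Longrightarrow> k \<le> n \<Longrightarrow> poly_Bernstein_coeff p n k \<le> poly p 1"
proof -
  define q where "q = - pcompose p [:1, -1:]"
  have q: "poly q y = - poly p (1 - y)" for y by (simp add: q_def poly_pcompose)
  have "strict_mono_on {0..1} (poly q)"
    by (rule strict_mono_onI) (auto simp: q intro: strict_mono_onD[OF mono])
  then obtain N where N: "\<And>n k. n \<ge> N \<Longrightarrow> k \<le> n \<Longrightarrow> poly q 0 \<le> poly_Bernstein_coeff q n k"
    using poly_Bernstein_coeff_lower by blast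
  have "poly_Bernstein_coeff p n k \<le> poly p 1" if "n \<ge> max N (degree p)" "k \<le> n" for n k
    using N[of n "n - k"] poly_Bernstein_coeff_reflect[of p n "n - k"] that
    by (simp add: q flip: q_def)
  then show ?thesis using that by blast
qed

section \<open>Lower bound for the increments of an increasing polynomial\<close>

lemma order_le_max_zero_order:
  assumes "q \<noteq> 0" "z \<in> {a..b}"
  shows "order z q \<le> max_zero_order a b q"
proof (cases "poly q z = 0")
  case True
  have "finite {x \<in> {a..b}. poly q x = 0}"
    using poly_roots_finite[OF assms(1)] by (rule rev_finite_subset) auto
  then show ?thesis using True assms by (auto simp: max_zero_order_def intro!: Max_ge)
qed (simp add: order_0I)

text \<open>Factoring \<open>f' u = (u - z)\<^sup>r q u\<close> with \<open>q z \<noteq> 0\<close>, the mean value theorem is applied on a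
  part of \<open>[x, y]\<close> that stays away from \<open>z\<close>. Monotonicity of \<open>f\<close> transfers the resulting
  bound to the whole of \<open>[x, y]\<close>; no sign condition on \<open>f'\<close> is needed.\<close>
lemma poly_increment_ge_near:
  fixes f :: "real poly"
  assumes mono: "mono_on {a..b} (poly f)" and g: "pderiv f \<noteq> 0"
    and ord: "order z (pderiv f) < s"
  obtains c d where "c > 0" "d > 0"
    "\<And>x y. {x, y} \<subseteq> {a..b} \<inter> ball z d \<Longrightarrow> x \<le> y \<Longrightarrow> poly f y - poly f x \<ge> c * (y - x) ^ s"
proof -
  define r where "r = order z (pderiv f)"
  obtain q where q: "pderiv f = [:- z, 1:] ^ r * q" "\<not> [:- z, 1:] dvd q"
    using order_decomp[OF g, of z] unfolding r_def by blast
  have fq: "poly (pderiv f) u = (u - z) ^ r * poly q u" for u by (simp add: q(1))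
  have qz: "poly q z \<noteq> 0" using q(2) by (simp add: poly_eq_0_iff_dvd)
  define c0 where "c0 = \<bar>poly q z\<bar> / 2"
  have c0: "c0 > 0" using qz by (simp add: c0_def)
  have "isCont (poly q) z" by simp
  then obtain d0 where d0: "d0 > 0" "\<And>u. dist u z < d0 \<Longrightarrow> dist (poly q u) (poly q z) < c0"
    using c0 unfolding continuous_at_eps_delta by blast
  define d where "d = min d0 1"
  have qlow: "\<bar>poly q u\<bar> \<ge> c0" if "u \<in> ball z d" for u
  proof -
    have "\<bar>poly q u - poly q z\<bar> < c0"
      using d0(2)[of u] that by (simp add: d_def dist_commute dist_real_def)
    then show ?thesis unfolding c0_def by linarith
  qed
  have "(c0 / 4 ^ s) * (y - x) ^ s \<le> poly f y - poly f x"
    if xy: "{x, y} \<subseteq> {a..b} \<inter> ball z d" "x \<le> y" for x y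
  proof (cases "x = y")
    case True
    then show ?thesis using ord by (simp add: power_0_left)
  next
    case False
    define h where "h = (y - x) / 4"
    have h: "0 < h" "h \<le> 1" using False xy by (auto simp: h_def d_def dist_real_def)
    have y4: "y = x + 4 * h" by (simp add: h_def field_simps)
    \<comment> \<open>The outer quarter of \<open>[x, y]\<close> on the side away from \<open>z\<close> keeps distance \<open>h\<close> from \<open>z\<close>.\<close>
    obtain x' where x': "x \<le> x'" "x' + h \<le> y" "\<And>u. x' < u \<Longrightarrow> u < x' + h \<Longrightarrow> h \<le> \<bar>u - z\<bar>"
    proof (cases "z \<le> x + 2 * h")
      case True
      then show ?thesis using h by (intro that[of "x + 3 * h"]) (auto simp: abs_if y4)
    next
      case False
      then show ?thesis using h by (intro that[of x]) (auto simp: abs_if y4)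
    qed
    obtain u where u: "x' < u" "u < x' + h"
        "poly f (x' + h) - poly f x' = h * poly (pderiv f) u"
      using poly_MVT[of x' "x' + h" f] h by auto
    have "u \<in> ball z d" using u x' xy by (auto simp: dist_real_def)
    have "(c0 / 4 ^ s) * (y - x) ^ s = c0 * h ^ s" by (simp add: h_def power_divide)
    also have "\<dots> \<le> c0 * h ^ Suc r"
      using h c0 ord by (intro mult_left_mono power_decreasing) (auto simp: r_def)
    also have "\<dots> = h * (h ^ r * c0)" by simp
    also have "\<dots> \<le> h * (\<bar>u - z\<bar> ^ r * \<bar>poly q u\<bar>)"
      using h c0 x'(3)[OF u(1,2)] qlow[OF \<open>u \<in> ball z d\<close>]
      by (intro mult_left_mono mult_mono power_mono) auto
    also have "\<dots> = \<bar>poly f (x' + h) - poly f x'\<bar>"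
      using h by (simp add: u(3) fq abs_mult power_abs)
    also have "\<dots> = poly f (x' + h) - poly f x'"
      using mono_onD[OF mono, of x' "x' + h"] x' xy h by auto
    also have "\<dots> \<le> poly f y - poly f x"
      using mono_onD[OF mono, of x x'] mono_onD[OF mono, of "x' + h" y] x' xy h by auto
    finally show ?thesis .
  qed
  then show ?thesis using c0 d0(1) by (intro that[of "c0 / 4 ^ s" d]) (auto simp: d_def)
qed

text \<open>The local bounds are combined by bisection. When two adjacent intervals are glued at
  \<open>v\<close>, one of the halves of \<open>[x, y]\<close> lies on a single side of \<open>v\<close>, so the constant only drops
  by a factor \<open>2\<^sup>s\<close>.\<close>
lemma poly_increment_ge:
  fixes f :: "real poly"
  assumes "a \<le> b" and mono: "mono_on {a..b} (poly f)" and g: "pderiv f \<noteq> 0"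
    and ord: "\<And>z. z \<in> {a..b} \<Longrightarrow> order z (pderiv f) < s"
  obtains c where "c > 0"
    "\<And>x y. {x, y} \<subseteq> {a..b} \<Longrightarrow> x \<le> y \<Longrightarrow> poly f y - poly f x \<ge> c * (y - x) ^ s"
proof -
  define P where "P = (\<lambda>u v. \<exists>c>0. \<forall>x y. {x, y} \<subseteq> {a..b} \<inter> {u..v} \<longrightarrow> x \<le> y \<longrightarrow>
      poly f y - poly f x \<ge> c * (y - x) ^ s)"
  have "P a b"
    using \<open>a \<le> b\<close>
  proof (induction rule: Bolzano)
    case (trans u v w)
    obtain c1 where c1: "c1 > 0" "\<And>x y. {x, y} \<subseteq> {a..b} \<inter> {u..v} \<Longrightarrow> x \<le> y \<Longrightarrow>
      poly f y - poly f x \<ge> c1 * (y - x) ^ s"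
      using trans(1) unfolding P_def by blast
    obtain c2 where c2: "c2 > 0" "\<And>x y. {x, y} \<subseteq> {a..b} \<inter> {v..w} \<Longrightarrow> x \<le> y \<Longrightarrow>
      poly f y - poly f x \<ge> c2 * (y - x) ^ s"
      using trans(2) unfolding P_def by blast
    define c where "c = min c1 c2 / 2 ^ s"
    have c: "c > 0" "c * t ^ s \<le> c1 * (t / 2) ^ s" "c * t ^ s \<le> c2 * (t / 2) ^ s" if "t \<ge> 0" for t
      using c1(1) c2(1) that
      by (auto simp: c_def power_divide intro!: divide_right_mono mult_right_mono)
    have "c * (y - x) ^ s \<le> poly f y - poly f x"
      if xy: "{x, y} \<subseteq> {a..b} \<inter> {u..w}" "x \<le> y" for x y
    proof -
      define h where "h = (y - x) / 2"
      note ch = c(2,3)[of "y - x", folded h_def]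
      have h: "h \<ge> 0" using xy by (simp add: h_def)
      define m where "m = x + h"
      have m: "x \<le> m" "m \<le> y" "m - x = h" "y - m = h" using xy by (auto simp: m_def h_def field_simps)
      have mon: "poly f x \<le> poly f m" "poly f m \<le> poly f y"
        using xy m by (auto intro!: mono_onD[OF mono])
      show ?thesis
      proof (cases "m \<le> v")
        case True
        then show ?thesis using c1(2)[of x m] ch mon xy m by auto
      next
        case False
        then show ?thesis using c2(2)[of m y] ch mon xy m by auto
      qed
    qed
    then show ?case using c(1)[of 0] unfolding P_def by blast
  next
    case (local z)
    obtain c d where cd: "c > 0" "d > 0" "\<And>x y. {x, y} \<subseteq> {a..b} \<inter> ball z d \<Longrightarrow> x \<le> y \<Longrightarrow>
      poly f y - poly f x \<ge> c * (y - x) ^ s"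
      using poly_increment_ge_near[OF mono g, of z s] ord[of z] local by auto
    have "P u v" if "u \<le> z \<and> z \<le> v \<and> v - u < d" for u v
    proof -
      have "{u..v} \<subseteq> ball z d" using that by (auto simp: dist_real_def)
      then have "\<forall>x y. {x, y} \<subseteq> {a..b} \<inter> {u..v} \<longrightarrow> x \<le> y \<longrightarrow>
          poly f y - poly f x \<ge> c * (y - x) ^ s"
        using cd(3) by (meson Int_mono order_refl order_trans)
      then show ?thesis using cd(1) unfolding P_def by blast
    qed
    then show ?case using \<open>d > 0\<close> by blast
  qed
  then show ?thesis using that unfolding P_def by auto
qed

section \<open>Existence and uniqueness of the operator\<close>

lemma bernstein_basis_eq_Bernstein:
  assumes "a < b" "k \<le> n"
  shows "bernstein_basis a b n k x = Bernstein n k ((x - a) / (b - a))"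
proof -
  have "1 - (x - a) / (b - a) = (b - x) / (b - a)"
    using assms by (simp add: field_simps)
  moreover have "(b - a) ^ n = (b - a) ^ k * (b - a) ^ (n - k)"
    using assms by (simp flip: power_add)
  ultimately show ?thesis
    by (simp add: bernstein_basis_def Bernstein_def power_divide)
qed

lemma affine_mem_interval:
  fixes a b y :: real
  assumes "a \<le> b" "y \<in> {0..1}"
  shows "a + y * (b - a) \<in> {a..b}"
proof -
  have "y * (b - a) \<le> b - a" "0 \<le> y * (b - a)"
    using assms by (auto intro: mult_left_le_one_le)
  then show ?thesis unfolding atLeastAtMost_iff by linarith
qed

lemma bernstein_basis_coeffs_unique:
  assumes "a < b"
    and eq: "\<And>x. x \<in> {a..b} \<Longrightarrow>
      (\<Sum>k\<le>n. c k * bernstein_basis a b n k x) = (\<Sum>k\<le>n. d k * bernstein_basis a b n k x)"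
    and "k \<le> n"
  shows "c k = d k"
proof (rule Bernstein_coeffs_unique[OF _ \<open>k \<le> n\<close>])
  fix y :: real assume y: "y \<in> {0..1}"
  define x where "x = a + y * (b - a)"
  have x: "x \<in> {a..b}" "(x - a) / (b - a) = y"
    using affine_mem_interval[of a b y] y \<open>a < b\<close> by (auto simp: x_def)
  have "bernstein_basis a b n k x = Bernstein n k y" if "k \<le> n" for k
    using that \<open>a < b\<close> by (simp add: bernstein_basis_eq_Bernstein x)
  then show "(\<Sum>k\<le>n. c k * Bernstein n k y) = (\<Sum>k\<le>n. d k * Bernstein n k y)"
    using eq[OF x(1)] by simp
qed

lemma bernstein_coeff_eqI:
  assumes "a < b"
    and f: "\<And>x. x \<in> {a..b} \<Longrightarrow> f x = (\<Sum>k\<le>n. \<gamma> k * bernstein_basis a b n k x)"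
    and "k \<le> n"
  shows "bernstein_coeff a b n f k = \<gamma> k"
proof -
  define \<gamma>' where "\<gamma>' = (\<lambda>k. if k \<le> n then \<gamma> k else 0)"
  have "bernstein_coeff a b n f = \<gamma>'"
    unfolding bernstein_coeff_def
  proof (rule the_equality)
    show "(\<forall>k>n. \<gamma>' k = 0) \<and> (\<forall>x\<in>{a..b}. f x = (\<Sum>k\<le>n. \<gamma>' k * bernstein_basis a b n k x))"
      by (simp add: f \<gamma>'_def)
  next
    fix \<beta> assume \<beta>: "(\<forall>k>n. \<beta> k = 0) \<and> (\<forall>x\<in>{a..b}. f x = (\<Sum>k\<le>n. \<beta> k * bernstein_basis a b n k x))"
    show "\<beta> = \<gamma>'"
    proof
      fix k
      show "\<beta> k = \<gamma>' k"
        using bernstein_basis_coeffs_unique[OF \<open>a < b\<close>, where c = \<beta> and d = \<gamma> and n = n and k = k] \<beta> f by (auto simp: \<gamma>'_def)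
    qed
  qed
  then show ?thesis using \<open>k \<le> n\<close> by (simp add: \<gamma>'_def)
qed

lemma sum_bernstein_basis:
  assumes "a < b"
  shows "(\<Sum>k\<le>n. bernstein_basis a b n k x) = 1"
  using assms by (simp add: bernstein_basis_eq_Bernstein)

text \<open>Comparing coefficients in \<open>\<Sum>\<^sub>k \<alpha>\<^sub>k p\<^sub>n\<^sub>,\<^sub>k = 1\<close> and \<open>\<Sum>\<^sub>k f (t\<^sub>k) \<alpha>\<^sub>k p\<^sub>n\<^sub>,\<^sub>k = f\<close> forces
  \<open>\<alpha>\<^sub>k = 1\<close> and \<open>f (t\<^sub>k) = \<gamma>\<^sub>k\<close>. So there is at most one such operator, and it exists if all
  \<open>\<gamma>\<^sub>k\<close> lie in the range \<open>[f a, f b]\<close>.\<close>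
lemma bernstein_op_exists:
  assumes "a < b" and mono: "strict_mono_on {a..b} f" and cont: "continuous_on {a..b} f"
    and f: "\<And>x. x \<in> {a..b} \<Longrightarrow> f x = (\<Sum>k\<le>n. \<gamma> k * bernstein_basis a b n k x)"
    and \<gamma>: "\<And>k. k \<le> n \<Longrightarrow> \<gamma> k \<in> {f a..f b}"
  shows "bernstein_well_defined a b n f"
    and "gen_bernstein_with a b n (bernstein_node a b n f) (\<lambda>_. 1) (bernstein_op a b n f)"
    and "k \<le> n \<Longrightarrow> bernstein_node a b n f k \<in> {a..b}"
    and "k \<le> n \<Longrightarrow> f (bernstein_node a b n f k) = \<gamma> k"
proof -
  define t where "t = bernstein_node a b n f"
  have inj: "inj_on f {a..b}" using mono by (rule strict_mono_on_imp_inj_on)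
  have t: "t k \<in> {a..b}" "f (t k) = \<gamma> k" if "k \<le> n" for k
  proof -
    obtain x where "x \<in> {a..b}" "f x = \<gamma> k"
      using IVT'[of f a "\<gamma> k" b] \<gamma>[OF \<open>k \<le> n\<close>] cont \<open>a < b\<close> by auto
    moreover have "t k = the_inv_into {a..b} f (\<gamma> k)"
      using bernstein_coeff_eqI[OF \<open>a < b\<close> f \<open>k \<le> n\<close>] by (simp add: t_def bernstein_node_def)
    ultimately show "t k \<in> {a..b}" "f (t k) = \<gamma> k"
      using the_inv_into_f_f[OF inj, of x] by auto
  qed
  then show "k \<le> n \<Longrightarrow> bernstein_node a b n f k \<in> {a..b}"
    and "k \<le> n \<Longrightarrow> f (bernstein_node a b n f k) = \<gamma> k"
    by (auto simp: t_def)
  define L where "L = (\<lambda>g\<in>{g. continuous_on {a..b} g}. \<lambda>x\<in>{a..b}.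
            \<Sum>k\<le>n. g (t k) * 1 * bernstein_basis a b n k x)"
  have L: "gen_bernstein_with a b n t (\<lambda>_. 1) L"
    using t by (auto simp: gen_bernstein_with_def L_def)
  have fix1: "fixes_on a b L (\<lambda>_. 1)"
    using \<open>a < b\<close> by (auto simp: fixes_on_def L_def sum_bernstein_basis)
  have fixf: "fixes_on a b L f"
    using t f cont by (auto simp: fixes_on_def L_def)
  have unique: "L' = L" if L': "gen_bernstein_operator a b n L' \<and> fixes_on a b L' (\<lambda>_. 1) \<and> fixes_on a b L' f" for L'
  proof -
    obtain t' \<alpha> where t': "\<And>k. k \<le> n \<Longrightarrow> t' k \<in> {a..b}" and
      L'_eq: "L' = (\<lambda>g\<in>{g. continuous_on {a..b} g}. \<lambda>x\<in>{a..b}.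
            \<Sum>k\<le>n. g (t' k) * \<alpha> k * bernstein_basis a b n k x)"
      using L' by (auto simp: gen_bernstein_operator_def gen_bernstein_with_def)
    have \<alpha>: "\<alpha> k = 1" if "k \<le> n" for k
    proof (rule bernstein_basis_coeffs_unique[OF \<open>a < b\<close> _ that])
      fix x assume "x \<in> {a..b}"
      then show "(\<Sum>k\<le>n. \<alpha> k * bernstein_basis a b n k x) = (\<Sum>k\<le>n. 1 * bernstein_basis a b n k x)"
        using L' \<open>a < b\<close> by (auto simp: fixes_on_def L'_eq sum_bernstein_basis)
    qed
    have "f (t' k) * \<alpha> k = \<gamma> k" if "k \<le> n" for k
    proof (rule bernstein_basis_coeffs_unique[OF \<open>a < b\<close> _ that])
      fix x assume "x \<in> {a..b}"
      then show "(\<Sum>k\<le>n. f (t' k) * \<alpha> k * bernstein_basis a b n k x) = (\<Sum>k\<le>n. \<gamma> k * bernstein_basis a b n k x)"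
        using L' cont f by (auto simp: fixes_on_def L'_eq)
    qed
    then have "t' k = t k" if "k \<le> n" for k
      using inj_onD[OF inj, of "t' k" "t k"] t t' \<alpha> that by auto
    then show "L' = L" using \<alpha> by (auto simp: L'_eq L_def fun_eq_iff restrict_def)
  qed
  have ex: "gen_bernstein_operator a b n L \<and> fixes_on a b L (\<lambda>_. 1) \<and> fixes_on a b L f"
    using L fix1 fixf unfolding gen_bernstein_operator_def by blast
  show "bernstein_well_defined a b n f"
    unfolding bernstein_well_defined_def using ex unique by blast
  have "bernstein_op a b n f = L"
    unfolding bernstein_op_def using ex unique by (rule the_equality)
  then show "gen_bernstein_with a b n (bernstein_node a b n f) (\<lambda>_. 1) (bernstein_op a b n f)"
    using L by (simp add: t_def)
qed

section \<open>Existence and convergence rate of the nodes\<close>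

theorem theorem6p9:
  fixes a b :: real and f1 :: "real poly" and m s :: nat
  assumes "a < b"
    and "strict_mono_on {a..b} (poly f1)"
    and "degree f1 = m"
    and "s = max_zero_order a b (pderiv f1) + 1"
  shows "\<exists>n0 K. n0 \<ge> m \<and> K > 0 \<and>
    (\<forall>n\<ge>n0.
       bernstein_well_defined a b n (poly f1) \<and>
       gen_bernstein_with a b n (bernstein_node a b n (poly f1)) (\<lambda>_. 1)
         (bernstein_op a b n (poly f1)) \<and>
       (\<forall>k\<le>n. \<bar>bernstein_node a b n (poly f1) k - (a + real k / real n * (b - a))\<bar>
                \<le> K / real n powr (1 / real s)))"
proof -
  note mono = assms(2)
  define p where "p = pcompose f1 [:a, b - a:]"
  have p: "poly p y = poly f1 (a + y * (b - a))" for y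
    by (simp add: p_def poly_pcompose)
  have degp: "degree p = m" using assms(1,3) by (simp add: p_def degree_pcompose)
  note aff = affine_mem_interval[OF less_imp_le[OF assms(1)]]
  have monop: "strict_mono_on {0..1} (poly p)"
    unfolding p using assms(1) aff
    by (intro strict_mono_onI strict_mono_onD[OF mono]) auto
  obtain N1 where N1: "\<And>n k. n \<ge> N1 \<Longrightarrow> k \<le> n \<Longrightarrow> poly p 0 \<le> poly_Bernstein_coeff p n k"
    using poly_Bernstein_coeff_lower[OF monop] by blast
  obtain N2 where N2: "\<And>n k. n \<ge> N2 \<Longrightarrow> k \<le> n \<Longrightarrow> poly_Bernstein_coeff p n k \<le> poly p 1"
    using poly_Bernstein_coeff_upper[OF monop] by blast
  obtain C where C: "C > 0" "\<And>n k. degree p \<le> n \<Longrightarrow> k \<le> n \<Longrightarrow>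
       \<bar>poly_Bernstein_coeff p n k - poly p (real k / real n)\<bar> \<le> C / real n"
    using poly_Bernstein_coeff_approx by blast
  have "pderiv f1 \<noteq> 0"
  proof
    assume "pderiv f1 = 0"
    then obtain c where "f1 = [:c:]" using pderiv_iszero by blast
    then show False using strict_mono_onD[OF mono, of a b] assms(1) by simp
  qed
  then obtain c where c: "c > 0" "\<And>x y. {x, y} \<subseteq> {a..b} \<Longrightarrow> x \<le> y \<Longrightarrow>
      poly f1 y - poly f1 x \<ge> c * (y - x) ^ s"
    using poly_increment_ge[of a b f1 s] assms strict_mono_on_imp_mono_on[OF mono]
      order_le_max_zero_order[of "pderiv f1" _ a b] by (auto simp: less_Suc_eq_le)
  have inc: "c * \<bar>y - x\<bar> ^ s \<le> \<bar>poly f1 y - poly f1 x\<bar>" if "x \<in> {a..b}" "y \<in> {a..b}" for x y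
    using c(2)[of x y] c(2)[of y x] that by (cases "x \<le> y") auto
  have s: "s > 0" using assms(4) by simp
  define K where "K = (C / c) powr (1 / real s)"
  define n0 where "n0 = Max {m, 1, N1, N2}"
  have "K > 0" using C(1) c(1) by (simp add: K_def)
  have main: "bernstein_well_defined a b n (poly f1) \<and>
       gen_bernstein_with a b n (bernstein_node a b n (poly f1)) (\<lambda>_. 1)
         (bernstein_op a b n (poly f1)) \<and>
       (\<forall>k\<le>n. \<bar>bernstein_node a b n (poly f1) k - (a + real k / real n * (b - a))\<bar>
                \<le> K / real n powr (1 / real s))" if "n \<ge> n0" for n
  proof -
    have n: "n \<ge> m" "n \<ge> 1" "n \<ge> N1" "n \<ge> N2" using that by (auto simp: n0_def)
    define \<gamma> where "\<gamma> = poly_Bernstein_coeff p n"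
    have rep: "poly f1 x = (\<Sum>k\<le>n. \<gamma> k * bernstein_basis a b n k x)" for x
    proof -
      have "poly f1 x = poly p ((x - a) / (b - a))" using assms(1) by (simp add: p)
      also have "\<dots> = (\<Sum>k\<le>n. \<gamma> k * Bernstein n k ((x - a) / (b - a)))"
        unfolding \<gamma>_def using n degp by (intro poly_eq_sum_Bernstein) simp
      finally show ?thesis using assms(1) by (simp add: bernstein_basis_eq_Bernstein)
    qed
    have \<gamma>: "\<gamma> k \<in> {poly f1 a..poly f1 b}" if "k \<le> n" for k
      using N1[OF n(3) that] N2[OF n(4) that] by (simp add: p \<gamma>_def)
    note op = bernstein_op_exists[OF assms(1) mono continuous_on_poly[OF continuous_on_id] rep \<gamma>]
    have "\<bar>bernstein_node a b n (poly f1) k - (a + real k / real n * (b - a))\<bar>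
                \<le> K / real n powr (1 / real s)" if k: "k \<le> n" for k
    proof -
      define x where "x = a + real k / real n * (b - a)"
      define t where "t = bernstein_node a b n (poly f1) k"
      have x: "x \<in> {a..b}" unfolding x_def using k n by (intro aff) (auto simp: divide_le_eq)
      have t: "t \<in> {a..b}" "poly f1 t = \<gamma> k"
        using op(3,4) k by (auto simp: t_def)
      have "c * \<bar>t - x\<bar> ^ s \<le> C / real n"
        using inc[OF x t(1)] C(2)[of n k] n k degp by (simp add: t(2) \<gamma>_def p x_def)
      then have "\<bar>t - x\<bar> ^ s \<le> C / real n / c"
        by (simp only: pos_le_divide_eq[OF c(1)] mult.commute)
      then have "\<bar>t - x\<bar> ^ s \<le> C / c / real n" by (simp add: mult.commute)
      then have "(\<bar>t - x\<bar> ^ s) powr (1 / real s) \<le> (C / c / real n) powr (1 / real s)"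
        by (intro powr_mono2) auto
      moreover have "(\<bar>t - x\<bar> ^ s) powr (1 / real s) = \<bar>t - x\<bar>"
        using s by (cases "t = x") (auto simp: powr_powr simp flip: powr_realpow)
      moreover have "(C / c / real n) powr (1 / real s) = K / real n powr (1 / real s)"
        using C(1) c(1) n by (simp add: K_def powr_divide powr_mult)
      ultimately show ?thesis by (simp add: t_def x_def)
    qed
    then show ?thesis using op(1,2) by blast
  qed
  have "n0 \<ge> m" by (simp add: n0_def)
  then show ?thesis using \<open>K > 0\<close> main by blast
qed

end
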